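(* Let $G$ be a (topologically) finitely generated profinite group and let $g\in G$. Then $g$ is isolated in $\tilde\Gamma(G)$ if and only if either $G=\langle g\rangle$ or $g\in\mathrm{Frat}(G)$.
   Context: Generation is always topological, and $\langle g\rangle$ denotes the closed subgroup topologically generated by $g$. A generating set $X$ of a profinite group $G$ is minimal if no proper subset of $X$ topologically generates $G$. The independence graph $\tilde\Gamma(G)$ is the graph whose vertices are the elements of $G$ and in which two vertices $x$ and $y$ are joined by an edge if and only if $x\neq y$ and there exists a finite minimal generating set of $G$ containing $x$ and $y$. $\mathrm{Frat}(G)$ is the Frattini subgroup of $G$, the intersection of all maximal open subgroups of $G$. The "either/or" is inclusive. *)

theory Defs
  imports "HOL-Algebra.Generated_Groups" "HOL-Analysis.Analysis"
begin

locale topological_group = group G for G (structure) and T :: "'a topology" +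
  assumes topspace_eq_carrier: "topspace T = carrier G"
    and continuous_mult: "continuous_map (prod_topology T T) T (\<lambda>(x, y). x \<otimes> y)"
    and continuous_inv: "continuous_map T T (\<lambda>x. inv x)"

definition totally_disconnected_space :: "'a topology \<Rightarrow> bool" where
  "totally_disconnected_space T \<longleftrightarrow>
     (\<forall>x \<in> topspace T. connected_component_of_set T x = {x})"

locale profinite_group = topological_group +
  assumes compact: "compact_space T"
    and Hausdorff: "Hausdorff_space T"
    and totally_disconnected: "totally_disconnected_space T"

text \<open>The closure of the abstract subgroup generated by \<open>S\<close>; in a topological group this is the
  smallest closed subgroup containing \<open>S\<close>.\<close>

definition top_generate :: "('a, 'b) monoid_scheme \<Rightarrow> 'a topology \<Rightarrow> 'a set \<Rightarrow> 'a set" where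
  "top_generate G T S = T closure_of (generate G S)"

definition generating_set :: "('a, 'b) monoid_scheme \<Rightarrow> 'a topology \<Rightarrow> 'a set \<Rightarrow> bool" where
  "generating_set G T S \<longleftrightarrow> S \<subseteq> carrier G \<and> top_generate G T S = carrier G"

definition top_finitely_generated :: "('a, 'b) monoid_scheme \<Rightarrow> 'a topology \<Rightarrow> bool" where
  "top_finitely_generated G T \<longleftrightarrow> (\<exists>S. finite S \<and> generating_set G T S)"

definition minimal_generating_set ::
  "('a, 'b) monoid_scheme \<Rightarrow> 'a topology \<Rightarrow> 'a set \<Rightarrow> bool" where
  "minimal_generating_set G T X \<longleftrightarrow>
     generating_set G T X \<and> (\<forall>Y. Y \<subset> X \<longrightarrow> \<not> generating_set G T Y)"

text \<open>A simple graph is a pair of a vertex set and a set of two-element edges.\<close>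

type_synonym 'a sgraph = "'a set \<times> 'a set set"

definition isolated_vertex :: "'a sgraph \<Rightarrow> 'a \<Rightarrow> bool" where
  "isolated_vertex \<Gamma> v \<longleftrightarrow> v \<in> fst \<Gamma> \<and> (\<forall>e \<in> snd \<Gamma>. v \<notin> e)"

definition independence_graph ::
  "('a, 'b) monoid_scheme \<Rightarrow> 'a topology \<Rightarrow> 'a sgraph" where
  "independence_graph G T =
     (carrier G,
      {{x, y} | x y. x \<in> carrier G \<and> y \<in> carrier G \<and> x \<noteq> y \<and>
         (\<exists>X. finite X \<and> minimal_generating_set G T X \<and> x \<in> X \<and> y \<in> X)})"

definition open_subgroup :: "('a, 'b) monoid_scheme \<Rightarrow> 'a topology \<Rightarrow> 'a set \<Rightarrow> bool" where
  "open_subgroup G T H \<longleftrightarrow> subgroup H G \<and> openin T H"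

text \<open>A subgroup containing an open subgroup is itself open, so it is immaterial whether \<open>H\<close> is
  required to be open here.\<close>

definition maximal_open_subgroup ::
  "('a, 'b) monoid_scheme \<Rightarrow> 'a topology \<Rightarrow> 'a set \<Rightarrow> bool" where
  "maximal_open_subgroup G T M \<longleftrightarrow>
     open_subgroup G T M \<and> M \<noteq> carrier G \<and>
     (\<forall>H. subgroup H G \<and> M \<subseteq> H \<longrightarrow> H = M \<or> H = carrier G)"

text \<open>Intersecting with the carrier makes the value \<open>carrier G\<close> when there is no maximal open
  subgroup, i.e. when the profinite group is trivial.\<close>

definition Frattini :: "('a, 'b) monoid_scheme \<Rightarrow> 'a topology \<Rightarrow> 'a set" where
  "Frattini G T = carrier G \<inter> \<Inter> {M. maximal_open_subgroup G T M}"

end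

theory Submission
  imports Defs
begin

text \<open>The main point is the converse direction. If \<open>g\<close> avoids some maximal open subgroup \<open>M\<close>, then
  \<open>G\<close> is abstractly generated by \<open>g\<close> and \<open>M\<close>, so the finitely many topological generators of \<open>G\<close>
  are words in \<open>g\<close> and finitely many elements of \<open>M\<close>. A subset \<open>Y\<close> of these elements that is
  minimal such that \<open>insert g Y\<close> generates \<open>G\<close> makes \<open>insert g Y\<close> a minimal generating set,
  as \<open>Y\<close> alone generates a subgroup of \<open>M\<close>; and \<open>Y\<close> is nonempty unless \<open>g\<close> generates \<open>G\<close>.
  The other direction rests on the fact that a proper closed subgroup lies in a maximal open
  one.\<close>

section \<open>Open conditions over compact sets, and finite support of words\<close>

text \<open>The tube lemma, packaged so that a condition quantified over a compact set stays open.
  It yields openness of stabilizers and of invariant sets below.\<close>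

lemma openin_compact_slices:
  assumes f: "continuous_map (prod_topology X Y) Z f"
    and C: "compactin Y C" and W: "openin Z W"
  shows "openin X {x \<in> topspace X. \<forall>c\<in>C. f (x, c) \<in> W}"
proof (subst openin_subopen, intro ballI)
  let ?P = "{p \<in> topspace (prod_topology X Y). f p \<in> W}"
  fix x assume x: "x \<in> {x \<in> topspace X. \<forall>c\<in>C. f (x, c) \<in> W}"
  have P: "openin (prod_topology X Y) ?P"
    using openin_continuous_map_preimage[OF f W] .
  have "C \<subseteq> topspace Y"
    using C compactin_subset_topspace by blast
  then have "{x} \<times> C \<subseteq> ?P"
    using x by auto
  then obtain U V where "openin X U" "x \<in> U" "C \<subseteq> V" "U \<times> V \<subseteq> ?P"
    using tube_lemma_right[OF P C, of x] x by auto
  then show "\<exists>U. openin X U \<and> x \<in> U \<and> U \<subseteq> {x \<in> topspace X. \<forall>c\<in>C. f (x, c) \<in> W}"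
    by (intro exI[of _ U]) (auto dest: openin_subset)
qed

text \<open>A word has finitely many letters; this lets a finite topological generating set be
  rewritten over a finite part of any abstract generating set.\<close>

lemma generate_finite_support:
  assumes "x \<in> generate G A"
  shows "\<exists>F. finite F \<and> F \<subseteq> A \<and> x \<in> generate G F"
  using assms
proof induction
  case one
  then show ?case by (intro exI[of _ "{}"]) (auto intro: generate.one)
next
  case (incl h)
  then show ?case by (intro exI[of _ "{h}"]) (auto intro: generate.incl)
next
  case (inv h)
  then show ?case by (intro exI[of _ "{h}"]) (auto intro: generate.inv)
next
  case (eng h1 h2)
  then obtain F1 F2 where "finite F1" "F1 \<subseteq> A" "h1 \<in> generate G F1"
    "finite F2" "F2 \<subseteq> A" "h2 \<in> generate G F2"
    by blast
  moreover have "generate G F \<subseteq> generate G (F1 \<union> F2)" if "F = F1 \<or> F = F2" for F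
  proof
    fix y assume "y \<in> generate G F"
    then show "y \<in> generate G (F1 \<union> F2)"
      using that by induction (auto intro: generate.intros)
  qed
  ultimately show ?case
    by (intro exI[of _ "F1 \<union> F2"]) (auto intro!: generate.eng)
qed

lemma generate_finite_supports:
  assumes "finite S" and "S \<subseteq> generate G A" and "group G"
  shows "\<exists>F. finite F \<and> F \<subseteq> A \<and> S \<subseteq> generate G F"
proof -
  have "\<forall>x\<in>S. \<exists>F. finite F \<and> F \<subseteq> A \<and> x \<in> generate G F"
    using assms(2) by (auto intro!: generate_finite_support)
  then obtain F where F: "\<And>x. x \<in> S \<Longrightarrow> finite (F x) \<and> F x \<subseteq> A \<and> x \<in> generate G (F x)"
    by metis
  have "generate G (F x) \<subseteq> generate G (\<Union>(F ` S))" if "x \<in> S" for x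
    using that by (intro group.mono_generate[OF assms(3)]) auto
  then have "S \<subseteq> generate G (\<Union>(F ` S))"
    using F by (meson subset_iff)
  moreover have "finite (\<Union>(F ` S))" "\<Union>(F ` S) \<subseteq> A"
    using F assms(1) by auto
  ultimately show ?thesis
    by blast
qed

section \<open>Open subgroups and generating sets of topological groups\<close>

context topological_group
begin

lemma continuous_map_group_mult:
  assumes "continuous_map X T f" "continuous_map X T h"
  shows "continuous_map X T (\<lambda>x. f x \<otimes> h x)"
  using continuous_map_compose[OF continuous_map_pairedI[OF assms] continuous_mult]
  by (simp add: o_def)

lemma continuous_map_group_inv:
  assumes "continuous_map X T f"
  shows "continuous_map X T (\<lambda>x. inv (f x))"
  using continuous_map_compose[OF assms continuous_inv] by (simp add: o_def)

lemma continuous_map_left_translation: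
  assumes "a \<in> carrier G"
  shows "continuous_map T T (\<lambda>x. a \<otimes> x)"
  using assms by (intro continuous_map_group_mult) (auto simp: topspace_eq_carrier)

lemma continuous_map_right_translation:
  assumes "a \<in> carrier G"
  shows "continuous_map T T (\<lambda>x. x \<otimes> a)"
  using assms by (intro continuous_map_group_mult) (auto simp: topspace_eq_carrier)

lemma openin_left_translate:
  assumes "openin T K" "a \<in> carrier G"
  shows "openin T {y \<in> carrier G. a \<otimes> y \<in> K}"
  using openin_continuous_map_preimage[OF continuous_map_left_translation[OF assms(2)] assms(1)]
  by (simp add: topspace_eq_carrier)

text \<open>A point \<open>x\<close> of the closure has the coset \<open>xM\<close> as an open
  neighbourhood; this coset meets \<open>M\<close>, which forces \<open>x\<close> into
  \<open>M\<close>.\<close>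

lemma open_subgroup_closure_subset:
  assumes "open_subgroup G T M"
  shows "T closure_of M \<subseteq> M"
proof
  fix x assume x: "x \<in> T closure_of M"
  have M: "subgroup M G" "openin T M"
    using assms by (auto simp: open_subgroup_def)
  have xG: "x \<in> carrier G"
    using x by (auto simp: in_closure_of topspace_eq_carrier)
  \<comment> \<open>This is the left coset \<open>xM\<close>, written as a preimage under
    translation by \<open>inv x\<close>.\<close>
  let ?W = "{y \<in> carrier G. inv x \<otimes> y \<in> M}"
  have "openin T ?W"
    using M xG by (intro openin_left_translate) auto
  moreover have "x \<in> ?W"
    using M xG by (auto simp: subgroup.one_closed)
  ultimately have "\<exists>y. y \<in> M \<and> y \<in> ?W"
    using x[unfolded in_closure_of] by presburger
  then obtain y where y: "y \<in> M" "inv x \<otimes> y \<in> M"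
    by blast
  have "x = y \<otimes> inv (inv x \<otimes> y)"
    using xG y M subgroup.mem_carrier[OF M(1)]
    by (simp add: inv_mult_group m_assoc[symmetric])
  then show "x \<in> M"
    using y M by (metis subgroup.m_closed subgroup.m_inv_closed)
qed

lemma top_generate_subset_open_subgroup:
  assumes "open_subgroup G T M" "X \<subseteq> M"
  shows "top_generate G T X \<subseteq> M"
proof -
  have "generate G X \<subseteq> M"
    using assms by (intro generate_subgroup_incl) (auto simp: open_subgroup_def)
  then show ?thesis
    unfolding top_generate_def
    using closure_of_mono[of "generate G X" M T] open_subgroup_closure_subset[OF assms(1)]
    by blast
qed

lemma generating_set_mono:
  assumes "generating_set G T S" "S \<subseteq> generate G X" "X \<subseteq> carrier G"
  shows "generating_set G T X"
proof -
  have "generate G S \<subseteq> generate G X"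
    using assms generate_is_subgroup by (intro generate_subgroup_incl) auto
  then have "carrier G \<subseteq> top_generate G T X"
    using assms(1) closure_of_mono[of "generate G S" "generate G X" T]
    unfolding generating_set_def top_generate_def by blast
  moreover have "top_generate G T X \<subseteq> carrier G"
    unfolding top_generate_def by (metis closure_of_subset_topspace topspace_eq_carrier)
  ultimately show ?thesis
    using assms(3) by (auto simp: generating_set_def)
qed

lemma generating_set_superset:
  assumes "generating_set G T S" "S \<subseteq> X" "X \<subseteq> carrier G"
  shows "generating_set G T X"
  using assms(2) by (intro generating_set_mono[OF assms(1) _ assms(3)]) (auto intro: generate.incl)

text \<open>\<open>L\<close> contains the open coset \<open>xK\<close> around each of its points
  \<open>x\<close>.\<close>

lemma open_subgroup_overgroup:
  assumes "open_subgroup G T K" "subgroup L G" "K \<subseteq> L"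
  shows "open_subgroup G T L"
proof -
  have "openin T L"
  proof (subst openin_subopen, intro ballI exI conjI)
    fix x assume x: "x \<in> L"
    let ?W = "{y \<in> carrier G. inv x \<otimes> y \<in> K}"
    have xG: "x \<in> carrier G"
      using x assms(2) subgroup.mem_carrier by metis
    show "openin T ?W"
      using assms(1) xG by (intro openin_left_translate) (auto simp: open_subgroup_def)
    show "x \<in> ?W"
      using assms(1) xG by (auto simp: open_subgroup_def subgroup.one_closed)
    show "?W \<subseteq> L"
    proof
      fix y assume y: "y \<in> ?W"
      then have "x \<otimes> (inv x \<otimes> y) \<in> L"
        using x assms by (auto intro: subgroup.m_closed)
      then show "y \<in> L"
        using y xG by (simp add: m_assoc[symmetric])
    qed
  qed
  then show ?thesis
    using assms(2) by (simp add: open_subgroup_def)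
qed

text \<open>The two conditions together say \<open>kC = C\<close>, which makes closure under
  inverses immediate. Compactness of \<open>C\<close> turns each of them into an open condition on
  \<open>k\<close>.\<close>

lemma stabilizer_open_subgroup:
  assumes "compactin T C" "openin T C"
  shows "open_subgroup G T {k \<in> carrier G. \<forall>c\<in>C. k \<otimes> c \<in> C \<and> inv k \<otimes> c \<in> C}"
    (is "open_subgroup G T ?K")
proof -
  have CG: "C \<subseteq> carrier G"
    using assms(2) openin_subset topspace_eq_carrier by blast
  have "subgroup ?K G"
  proof (rule subgroupI)
    show "?K \<subseteq> carrier G" by blast
    show "?K \<noteq> {}" using CG by (auto intro!: exI[of _ \<one>])
    show "inv a \<in> ?K" if "a \<in> ?K" for a using that by auto
    show "a \<otimes> b \<in> ?K" if "a \<in> ?K" "b \<in> ?K" for a b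
      using that CG by (auto simp: inv_mult_group m_assoc subset_iff)
  qed
  moreover have "openin T ?K"
  proof -
    have "openin T {x \<in> topspace T. \<forall>c\<in>C. (\<lambda>p. fst p \<otimes> snd p) (x, c) \<in> C}"
      by (intro openin_compact_slices[OF _ assms] continuous_map_group_mult
          continuous_map_fst continuous_map_snd)
    moreover have "openin T {x \<in> topspace T. \<forall>c\<in>C. (\<lambda>p. inv (fst p) \<otimes> snd p) (x, c) \<in> C}"
      by (intro openin_compact_slices[OF _ assms] continuous_map_group_mult
          continuous_map_group_inv continuous_map_fst continuous_map_snd)
    ultimately have "openin T ({x \<in> topspace T. \<forall>c\<in>C. x \<otimes> c \<in> C} \<inter>
        {x \<in> topspace T. \<forall>c\<in>C. inv x \<otimes> c \<in> C})"
      by (auto intro: openin_Int)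
    also have "\<dots> = ?K"
      by (auto simp: topspace_eq_carrier)
    finally show ?thesis .
  qed
  ultimately show ?thesis
    by (simp add: open_subgroup_def)
qed

end

section \<open>Proper closed subgroups and maximal open subgroups in profinite groups\<close>

context profinite_group
begin

text \<open>In a locally compact Hausdorff space a compact connected component can be separated from
  a disjoint closed set by a clopen set; total disconnectedness makes \<open>{x}\<close> such a
  component.\<close>

lemma clopen_separation:
  assumes "closedin T H" "x \<in> carrier G" "x \<notin> H"
  obtains U where "closedin T U" "openin T U" "H \<subseteq> U" "x \<notin> U"
proof -
  have "separated_between T {x} H"
  proof (rule separated_between_compact_connected_component)
    show "locally_compact_space T"
      using compact compact_imp_locally_compact_space Hausdorff by blast
    show "{x} \<in> connected_components_of T"
      using totally_disconnected assms(2)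
      unfolding totally_disconnected_space_def connected_components_of_def
      by (auto simp: topspace_eq_carrier)
    show "compactin T {x}"
      using assms(2) by (simp add: topspace_eq_carrier)
  qed (use assms Hausdorff in auto)
  then have "separated_between T H {x}"
    by (simp add: separated_between_sym)
  then show ?thesis
    using that unfolding separated_between by blast
qed

text \<open>If \<open>U\<close> is clopen, contains the closure of \<open>H\<close> and misses a point, then the elements all of
  whose left \<open>H\<close>-translates lie in \<open>U\<close> form an \<open>H\<close>-invariant clopen set, whose stabilizer is
  the subgroup sought.\<close>

lemma proper_closed_subgroup_in_open:
  assumes H: "subgroup H G" and proper: "T closure_of H \<noteq> carrier G"
  obtains K where "open_subgroup G T K" "H \<subseteq> K" "K \<noteq> carrier G"
proof -
  have HG: "H \<subseteq> carrier G"
    using H subgroup.subset by blast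
  obtain x where x: "x \<in> carrier G" "x \<notin> T closure_of H"
    using proper closure_of_subset_topspace[of T H] by (auto simp: topspace_eq_carrier)
  obtain U where U: "closedin T U" "openin T U" "T closure_of H \<subseteq> U" "x \<notin> U"
    using clopen_separation[OF closedin_closure_of x] by blast
  define C where "C = {u \<in> carrier G. \<forall>h\<in>H. h \<otimes> u \<in> U}"
  \<comment> \<open>For fixed \<open>u\<close> the condition on \<open>h\<close> is closed, so it
    passes from \<open>H\<close> to its closure. The closure is compact, so \<open>C\<close> becomes
    a set of compact slices and hence open.\<close>
  have C_closure: "C = {u \<in> topspace T. \<forall>h\<in>T closure_of H. (\<lambda>p. snd p \<otimes> fst p) (u, h) \<in> U}"
  proof -
    have "h \<otimes> u \<in> U" if u: "u \<in> C" and h: "h \<in> T closure_of H" for u h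
    proof -
      have "closedin T {y \<in> topspace T. y \<otimes> u \<in> U}"
        using u U(1) continuous_map_right_translation
        by (intro closedin_continuous_map_preimage) (auto simp: C_def)
      moreover have "H \<subseteq> {y \<in> topspace T. y \<otimes> u \<in> U}"
        using u HG by (auto simp: C_def topspace_eq_carrier)
      ultimately show ?thesis
        using h closure_of_minimal[of H] by blast
    qed
    moreover have "H \<subseteq> T closure_of H"
      using HG closure_of_subset by (simp add: topspace_eq_carrier closure_of_subset)
    ultimately show ?thesis
      by (auto simp: C_def topspace_eq_carrier)
  qed
  have "compactin T (T closure_of H)"
    by (intro closedin_compact_space compact closedin_closure_of)
  moreover have "continuous_map (prod_topology T T) T (\<lambda>p. snd p \<otimes> fst p)"
    by (intro continuous_map_group_mult continuous_map_fst continuous_map_snd)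
  ultimately have C_open: "openin T C"
    using openin_compact_slices U(2) unfolding C_closure by blast
  \<comment> \<open>As an intersection of preimages of the closed set \<open>U\<close>,
    \<open>C\<close> is also closed, hence compact.\<close>
  have "closedin T (\<Inter>h\<in>H. {u \<in> topspace T. h \<otimes> u \<in> U})"
    using U(1) HG subgroup.one_closed[OF H]
    by (intro closedin_INT closedin_continuous_map_preimage[OF continuous_map_left_translation])
      auto
  moreover have "(\<Inter>h\<in>H. {u \<in> topspace T. h \<otimes> u \<in> U}) = C"
    using subgroup.one_closed[OF H] by (auto simp: C_def topspace_eq_carrier)
  ultimately have "compactin T C"
    using closedin_compact_space[OF compact] by metis
  let ?K = "{k \<in> carrier G. \<forall>c\<in>C. k \<otimes> c \<in> C \<and> inv k \<otimes> c \<in> C}"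
  have one_C: "\<one> \<in> C"
    using HG U(3) closure_of_subset[of H T] by (auto simp: C_def topspace_eq_carrier subset_iff)
  have mult_C: "h \<otimes> c \<in> C" if "h \<in> H" "c \<in> C" for h c
    using that HG subgroup.m_closed[OF H]
    by (auto simp: C_def m_assoc[symmetric] subset_iff)
  show ?thesis
  proof
    show "open_subgroup G T ?K"
      by (rule stabilizer_open_subgroup) fact+
    show "H \<subseteq> ?K"
      using HG mult_C subgroup.m_inv_closed[OF H] by blast
    \<comment> \<open>As \<open>\<one>\<close> lies in \<open>H\<close>, \<open>C\<close> is
      contained in \<open>U\<close>. As \<open>\<one>\<close> lies in \<open>C\<close>, each
      \<open>k\<close> in \<open>?K\<close> equals \<open>k \<otimes> \<one>\<close> and so lies in
      \<open>C\<close>. Thus \<open>?K\<close> misses \<open>x\<close>.\<close>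
    have "x \<notin> C"
      using U(4) subgroup.one_closed[OF H] x(1) by (force simp: C_def)
    then have "x \<notin> ?K"
      using one_C x(1) by force
    then show "?K \<noteq> carrier G"
      using x(1) by blast
  qed
qed

text \<open>By compactness finitely many left cosets of \<open>K\<close> cover the group, and every
  overgroup is a union of some of them.\<close>

lemma finite_overgroups:
  assumes K: "open_subgroup G T K"
  shows "finite {L. subgroup L G \<and> K \<subseteq> L}"
proof -
  define W where "W x = {y \<in> carrier G. inv x \<otimes> y \<in> K}" for x
  have "openin T (W x)" if "x \<in> carrier G" for x
    unfolding W_def using K that by (intro openin_left_translate) (auto simp: open_subgroup_def)
  moreover have "x \<in> W x" if "x \<in> carrier G" for x
    using K that by (auto simp: W_def open_subgroup_def subgroup.one_closed)
  ultimately have "(\<forall>V\<in>W ` carrier G. openin T V) \<and> topspace T \<subseteq> \<Union>(W ` carrier G)"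
    by (auto simp: topspace_eq_carrier)
  then obtain \<F> where "finite \<F>" "\<F> \<subseteq> W ` carrier G" "topspace T \<subseteq> \<Union>\<F>"
    using compact unfolding compact_space_alt by meson
  then obtain F where F: "finite F" "F \<subseteq> carrier G" "carrier G \<subseteq> \<Union>(W ` F)"
    by (metis finite_subset_image topspace_eq_carrier)
  have "L = \<Union>(W ` (F \<inter> L))" if L: "subgroup L G" and "K \<subseteq> L" for L
  proof -
    \<comment> \<open>Membership in \<open>L\<close> is constant on each coset \<open>xK\<close>, so
      \<open>L\<close> is determined by the representatives it contains.\<close>
    have iff: "x \<in> L \<longleftrightarrow> y \<in> L" if "x \<in> carrier G" "y \<in> W x" for x y
    proof -
      let ?k = "inv x \<otimes> y"
      have y: "y \<in> carrier G" "?k \<in> L" "inv ?k \<in> L"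
        using that \<open>K \<subseteq> L\<close> subgroup.m_inv_closed[OF L] by (auto simp: W_def)
      moreover have "x \<otimes> ?k = y" "y \<otimes> inv ?k = x"
        using that(1) y(1) by (simp_all add: inv_mult_group m_assoc[symmetric])
      ultimately show ?thesis
        by (metis L subgroup.m_closed)
    qed
    show ?thesis
    proof
      show "L \<subseteq> \<Union>(W ` (F \<inter> L))"
      proof
        fix y assume "y \<in> L"
        moreover from this obtain x where "x \<in> F" "y \<in> W x"
          using F(3) subgroup.mem_carrier[OF L] by blast
        ultimately show "y \<in> \<Union>(W ` (F \<inter> L))"
          using iff F(2) by blast
      qed
      show "\<Union>(W ` (F \<inter> L)) \<subseteq> L"
        using iff F(2) by blast
    qed
  qed
  then have "{L. subgroup L G \<and> K \<subseteq> L} \<subseteq> (\<lambda>A. \<Union>(W ` A)) ` Pow F"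
    by blast
  then show ?thesis
    using F(1) finite_subset by blast
qed

text \<open>An open proper overgroup \<open>K\<close> of \<open>H\<close> has only finitely many
  overgroups, so a maximal proper one exists without Zorn's lemma.\<close>

lemma proper_closed_subgroup_in_maximal:
  assumes "subgroup H G" and "T closure_of H \<noteq> carrier G"
  obtains M where "maximal_open_subgroup G T M" "H \<subseteq> M"
proof -
  obtain K where K: "open_subgroup G T K" "H \<subseteq> K" "K \<noteq> carrier G"
    using proper_closed_subgroup_in_open[OF assms] by blast
  let ?A = "{L. subgroup L G \<and> K \<subseteq> L} - {carrier G}"
  have "finite ?A" "K \<in> ?A"
    using K finite_overgroups by (auto simp: open_subgroup_def)
  from finite_has_maximal2[OF this]
  obtain M where M: "M \<in> ?A" "\<forall>L\<in>?A. M \<subseteq> L \<longrightarrow> M = L"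
    by auto
  then have "open_subgroup G T M"
    using open_subgroup_overgroup[OF K(1), of M] by blast
  \<comment> \<open>Any subgroup above \<open>M\<close> also contains \<open>K\<close>, so
    maximality within \<open>?A\<close> is maximality among all proper subgroups.\<close>
  then have "maximal_open_subgroup G T M"
    unfolding maximal_open_subgroup_def using M by blast
  then show ?thesis
    using that M(1) K(2) by blast
qed

text \<open>Otherwise some maximal open subgroup contains \<open>X - {g}\<close>. It contains
  \<open>g\<close> as well, hence all of \<open>X\<close>, and being closed it contains the whole
  group.\<close>

lemma Frattini_nongenerator:
  assumes g: "g \<in> Frattini G T" and X: "generating_set G T X"
  shows "generating_set G T (X - {g})"
proof (rule ccontr)
  assume *: "\<not> ?thesis"
  have XG: "X \<subseteq> carrier G"
    using X by (simp add: generating_set_def)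
  then have "subgroup (generate G (X - {g})) G"
    by (intro generate_is_subgroup) auto
  moreover have "T closure_of generate G (X - {g}) \<noteq> carrier G"
    using * XG by (auto simp: generating_set_def top_generate_def)
  ultimately obtain M where M: "maximal_open_subgroup G T M" "generate G (X - {g}) \<subseteq> M"
    using proper_closed_subgroup_in_maximal by metis
  then have "X \<subseteq> M"
    using g generate.incl[of _ "X - {g}" G] unfolding Frattini_def by blast
  with M(1) have "top_generate G T X \<subseteq> M"
    by (intro top_generate_subset_open_subgroup) (auto simp: maximal_open_subgroup_def)
  then show False
    using X M(1)
    by (auto simp: generating_set_def maximal_open_subgroup_def open_subgroup_def
        dest: subgroup.subset)
qed

end

section \<open>Minimal generating sets through a given element, and isolated vertices\<close>

lemma (in topological_group) minimal_generating_set_outside_maximal: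
  assumes fg: "top_finitely_generated G T" and g: "g \<in> carrier G"
    and M: "maximal_open_subgroup G T M" and gM: "g \<notin> M"
  obtains Y where "finite Y" "Y \<subseteq> M" "minimal_generating_set G T (insert g Y)"
proof -
  have M': "open_subgroup G T M" "subgroup M G" "M \<noteq> carrier G"
    using M by (auto simp: maximal_open_subgroup_def open_subgroup_def)
  have MG: "M \<subseteq> carrier G"
    using M'(2) subgroup.subset by blast
  obtain S where S: "finite S" "generating_set G T S"
    using fg by (auto simp: top_finitely_generated_def)
  have "subgroup (generate G (insert g M)) G"
    using g MG by (intro generate_is_subgroup) auto
  moreover have "insert g M \<subseteq> generate G (insert g M)"
    by (auto intro: generate.incl)
  ultimately have "generate G (insert g M) = carrier G"
    using M gM unfolding maximal_open_subgroup_def by blast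
  then obtain F where F: "finite F" "F \<subseteq> insert g M" "S \<subseteq> generate G F"
    using generate_finite_supports[OF S(1), of G "insert g M"] S(2) is_group
    by (auto simp: generating_set_def)
  \<comment> \<open>\<open>g\<close> is kept apart from the candidates \<open>Z\<close>, so that
    minimizing cannot discard it and every candidate lies in \<open>M\<close>.\<close>
  let ?A = "{Z. Z \<subseteq> F - {g} \<and> generating_set G T (insert g Z)}"
  have "generating_set G T F"
    using S(2) F g MG by (intro generating_set_mono[OF S(2)]) auto
  then have "generating_set G T (insert g (F - {g}))"
    by (rule generating_set_superset) (use F g MG in auto)
  then have "F - {g} \<in> ?A"
    by blast
  moreover have "finite ?A"
    using F(1) by (auto intro: finite_subset[of _ "Pow F"])
  ultimately obtain Y where Y: "Y \<in> ?A" "\<forall>Z\<in>?A. Z \<subseteq> Y \<longrightarrow> Y = Z"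
    using finite_has_minimal2[of ?A "F - {g}"] by auto
  have YM: "Y \<subseteq> M"
    using Y(1) F(2) by blast
  \<comment> \<open>A proper subset containing \<open>g\<close> would contradict the minimality of
    \<open>Y\<close>; one without \<open>g\<close> lies in \<open>M\<close>, which is closed and
    proper.\<close>
  have "\<not> generating_set G T Z" if Z: "Z \<subset> insert g Y" for Z
  proof
    assume gen: "generating_set G T Z"
    show False
    proof (cases "g \<in> Z")
      case True
      then have "Z - {g} \<in> ?A" "Z - {g} \<subseteq> Y"
        using gen Z Y(1) by (auto simp: insert_absorb)
      then have "Y = Z - {g}"
        using Y(2) by blast
      with True Z show False by blast
    next
      case False
      then have "top_generate G T Z \<subseteq> M"
        using Z YM by (intro top_generate_subset_open_subgroup[OF M'(1)]) blast
      with gen M' MG show False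
        by (auto simp: generating_set_def)
    qed
  qed
  with Y(1) have "minimal_generating_set G T (insert g Y)"
    by (auto simp: minimal_generating_set_def)
  moreover have "finite Y"
    using Y(1) F(1) finite_subset by blast
  ultimately show ?thesis
    using that YM by blast
qed

text \<open>This removes the graph from the problem: a second element of \<open>X\<close> would be a
  neighbour of \<open>g\<close>, and an edge at \<open>g\<close> needs an \<open>X\<close> with two
  distinct elements.\<close>

lemma isolated_independence_graph_iff:
  assumes "g \<in> carrier G"
  shows "isolated_vertex (independence_graph G T) g \<longleftrightarrow>
    (\<forall>X. finite X \<and> minimal_generating_set G T X \<and> g \<in> X \<longrightarrow> X = {g})"
    (is "?L \<longleftrightarrow> ?R")
proof
  assume L: ?L
  show ?R
  proof (intro allI impI, rule ccontr)
    fix X assume X: "finite X \<and> minimal_generating_set G T X \<and> g \<in> X" and "X \<noteq> {g}"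
    then obtain y where y: "y \<in> X" "y \<noteq> g"
      by blast
    moreover have "y \<in> carrier G"
      using X y by (auto simp: minimal_generating_set_def generating_set_def)
    ultimately have "{g, y} \<in> snd (independence_graph G T)"
      using X assms unfolding independence_graph_def by auto
    then show False
      using L unfolding isolated_vertex_def by blast
  qed
next
  assume R: ?R
  have False if "e \<in> snd (independence_graph G T)" and "g \<in> e" for e
  proof -
    obtain x y X where "e = {x, y}" "x \<noteq> y" "finite X" "minimal_generating_set G T X"
      "x \<in> X" "y \<in> X"
      using \<open>e \<in> snd (independence_graph G T)\<close> unfolding independence_graph_def by auto
    moreover from this have "X = {g}"
      using \<open>g \<in> e\<close> R by blast
    ultimately show False
      by blast
  qed
  then show ?L
    using assms by (auto simp: isolated_vertex_def independence_graph_def)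
qed

theorem lemma15:
  fixes G :: "('a, 'b) monoid_scheme" and T :: "'a topology" and g :: 'a
  assumes "profinite_group G T"
    and "top_finitely_generated G T"
    and "g \<in> carrier G"
  shows "isolated_vertex (independence_graph G T) g \<longleftrightarrow>
    carrier G = top_generate G T {g} \<or> g \<in> Frattini G T"
proof -
  interpret profinite_group G T by fact
  show ?thesis
    unfolding isolated_independence_graph_iff[OF assms(3)]
  proof (intro iffI allI impI disjCI)
    assume isolated: "\<forall>X. finite X \<and> minimal_generating_set G T X \<and> g \<in> X \<longrightarrow> X = {g}"
      and "g \<notin> Frattini G T"
    then obtain M where "maximal_open_subgroup G T M" "g \<notin> M"
      using assms(3) by (auto simp: Frattini_def)
    then obtain Y where "finite Y" "minimal_generating_set G T (insert g Y)"
      using minimal_generating_set_outside_maximal[OF assms(2,3)] by metis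
    moreover from this have "insert g Y = {g}"
      using isolated by (metis finite_insert insertI1)
    ultimately show "carrier G = top_generate G T {g}"
      by (simp add: minimal_generating_set_def generating_set_def)
  next
    fix X
    assume *: "carrier G = top_generate G T {g} \<or> g \<in> Frattini G T"
      and X: "finite X \<and> minimal_generating_set G T X \<and> g \<in> X"
    from * show "X = {g}"
    proof
      \<comment> \<open>Here \<open>{g}\<close> is a generating subset of the minimal set
        \<open>X\<close>, so the two coincide.\<close>
      assume "carrier G = top_generate G T {g}"
      then have "generating_set G T {g}"
        using assms(3) by (simp add: generating_set_def)
      then show ?thesis
        using X unfolding minimal_generating_set_def by blast
    next
      \<comment> \<open>Here no minimal generating set contains \<open>g\<close>: the proper subset
        \<open>X - {g}\<close> would still generate, so the goal follows by contradiction.\<close>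
      assume "g \<in> Frattini G T"
      then have "generating_set G T (X - {g})"
        using Frattini_nongenerator X by (auto simp: minimal_generating_set_def)
      then show ?thesis
        using X unfolding minimal_generating_set_def by blast
    qed
  qed
qed

end
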